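(* (In ZF.) For every finite $k$, the $k$-Trichotomy Principle implies the Well-Ordering Principle. That is: let $k$ be a natural number and suppose that for every family $\mathcal{F}$ of sets of cardinality $k$ there exist distinct sets $A,B\in\mathcal{F}$ and an injective map $A\to B$. Then every set admits a well-ordering.
   Context: The base theory is ZF (no Axiom of Choice). A family of sets $\mathcal{F}$ "contains an injective" if there exists at least one injective map whose source and target are distinct sets in $\mathcal{F}$. The $k$-Trichotomy Principle is the statement that every family of sets of cardinality $k$ contains an injective. The Well-Ordering Principle is the statement that every set admits a well-ordering. *)

theory Defs
  imports Main
begin

text \<open>
  HOL proves the axiom of choice, so a statement about HOL sets, or about a universe whose
  Separation or Replacement admits arbitrary HOL predicates, would make the well-ordering principle
  outright provable.  ZF is therefore taken as a first-order theory: its models are arbitrary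
  membership structures, and the two schemas range over formulas of the language of set theory.
  Natural numbers, maps, and well-orderings are those of the model.
\<close>

datatype fm =
    Mem nat nat
  | Eq nat nat
  | Neg fm
  | Conj fm fm
  | Forall nat fm

locale membership =
  fixes mem :: "'a \<Rightarrow> 'a \<Rightarrow> bool"  (infix "\<^bold>\<in>" 50)
begin

primrec sat :: "(nat \<Rightarrow> 'a) \<Rightarrow> fm \<Rightarrow> bool" where
  "sat v (Mem i j) \<longleftrightarrow> v i \<^bold>\<in> v j"
| "sat v (Eq i j) \<longleftrightarrow> v i = v j"
| "sat v (Neg \<phi>) \<longleftrightarrow> \<not> sat v \<phi>"
| "sat v (Conj \<phi> \<psi>) \<longleftrightarrow> sat v \<phi> \<and> sat v \<psi>"
| "sat v (Forall i \<phi>) \<longleftrightarrow> (\<forall>a. sat (v(i := a)) \<phi>)"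

definition subset_of :: "'a \<Rightarrow> 'a \<Rightarrow> bool" where
  "subset_of A B \<longleftrightarrow> (\<forall>x. x \<^bold>\<in> A \<longrightarrow> x \<^bold>\<in> B)"

definition is_empty :: "'a \<Rightarrow> bool" where
  "is_empty A \<longleftrightarrow> (\<forall>x. \<not> x \<^bold>\<in> A)"

definition is_upair :: "'a \<Rightarrow> 'a \<Rightarrow> 'a \<Rightarrow> bool" where
  "is_upair a b C \<longleftrightarrow> (\<forall>x. x \<^bold>\<in> C \<longleftrightarrow> x = a \<or> x = b)"

text \<open>Kuratowski pairs: \<open>p = {{a}, {a, b}}\<close>.\<close>

definition is_pair :: "'a \<Rightarrow> 'a \<Rightarrow> 'a \<Rightarrow> bool" where
  "is_pair a b p \<longleftrightarrow> (\<exists>s t. is_upair a a s \<and> is_upair a b t \<and> is_upair s t p)"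

definition is_succ :: "'a \<Rightarrow> 'a \<Rightarrow> bool" where
  "is_succ x y \<longleftrightarrow> (\<forall>z. z \<^bold>\<in> y \<longleftrightarrow> z \<^bold>\<in> x \<or> z = x)"

definition is_inductive :: "'a \<Rightarrow> bool" where
  "is_inductive A \<longleftrightarrow>
     (\<exists>e. is_empty e \<and> e \<^bold>\<in> A) \<and> (\<forall>x. x \<^bold>\<in> A \<longrightarrow> (\<exists>y. is_succ x y \<and> y \<^bold>\<in> A))"

text \<open>Membership in the model's own \<open>\<omega>\<close>, which may contain non-standard elements.\<close>

definition is_natural :: "'a \<Rightarrow> bool" where
  "is_natural n \<longleftrightarrow> (\<forall>A. is_inductive A \<longrightarrow> n \<^bold>\<in> A)"

text \<open>\<open>related r a b\<close>: the pair of \<open>a\<close> and \<open>b\<close> is an element of the set \<open>r\<close>.\<close>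

definition related :: "'a \<Rightarrow> 'a \<Rightarrow> 'a \<Rightarrow> bool" where
  "related r a b \<longleftrightarrow> (\<exists>p. is_pair a b p \<and> p \<^bold>\<in> r)"

definition is_relation :: "'a \<Rightarrow> 'a \<Rightarrow> 'a \<Rightarrow> bool" where
  "is_relation r A B \<longleftrightarrow> (\<forall>p. p \<^bold>\<in> r \<longrightarrow> (\<exists>a b. a \<^bold>\<in> A \<and> b \<^bold>\<in> B \<and> is_pair a b p))"

definition is_map :: "'a \<Rightarrow> 'a \<Rightarrow> 'a \<Rightarrow> bool" where
  "is_map f A B \<longleftrightarrow> is_relation f A B \<and> (\<forall>a. a \<^bold>\<in> A \<longrightarrow> (\<exists>!b. related f a b))"

definition is_injection :: "'a \<Rightarrow> 'a \<Rightarrow> 'a \<Rightarrow> bool" where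
  "is_injection f A B \<longleftrightarrow>
     is_map f A B \<and> (\<forall>a a' b. related f a b \<and> related f a' b \<longrightarrow> a = a')"

definition is_bijection :: "'a \<Rightarrow> 'a \<Rightarrow> 'a \<Rightarrow> bool" where
  "is_bijection f A B \<longleftrightarrow>
     is_injection f A B \<and> (\<forall>b. b \<^bold>\<in> B \<longrightarrow> (\<exists>a. related f a b))"

definition equinumerous :: "'a \<Rightarrow> 'a \<Rightarrow> bool" where
  "equinumerous A B \<longleftrightarrow> (\<exists>f. is_bijection f A B)"

definition contains_injective :: "'a \<Rightarrow> bool" where
  "contains_injective F \<longleftrightarrow>
     (\<exists>A B. A \<^bold>\<in> F \<and> B \<^bold>\<in> F \<and> A \<noteq> B \<and> (\<exists>f. is_injection f A B))"

definition trichotomy_principle :: "'a \<Rightarrow> bool" where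
  "trichotomy_principle k \<longleftrightarrow> (\<forall>F. equinumerous F k \<longrightarrow> contains_injective F)"

text \<open>Well-orderings are taken in their strict form.\<close>

definition is_well_ordering :: "'a \<Rightarrow> 'a \<Rightarrow> bool" where
  "is_well_ordering r X \<longleftrightarrow>
     is_relation r X X \<and>
     (\<forall>x. \<not> related r x x) \<and>
     (\<forall>x y z. related r x y \<and> related r y z \<longrightarrow> related r x z) \<and>
     (\<forall>x y. x \<^bold>\<in> X \<and> y \<^bold>\<in> X \<longrightarrow> x = y \<or> related r x y \<or> related r y x) \<and>
     (\<forall>S. subset_of S X \<and> \<not> is_empty S \<longrightarrow>
        (\<exists>m. m \<^bold>\<in> S \<and> (\<forall>x. x \<^bold>\<in> S \<longrightarrow> x = m \<or> related r m x)))"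

definition well_ordering_principle :: bool where
  "well_ordering_principle \<longleftrightarrow> (\<forall>X. \<exists>r. is_well_ordering r X)"

end

text \<open>
  In the two schemas, variables \<open>0\<close> and \<open>1\<close> are the designated arguments of the formula, and the
  assignment \<open>v\<close> supplies the parameters.
\<close>

locale ZF_model = membership +
  assumes extensionality: "(\<forall>x. x \<^bold>\<in> A \<longleftrightarrow> x \<^bold>\<in> B) \<Longrightarrow> A = B"
    and foundation: "x \<^bold>\<in> A \<Longrightarrow> \<exists>m. m \<^bold>\<in> A \<and> (\<forall>y. y \<^bold>\<in> A \<longrightarrow> \<not> y \<^bold>\<in> m)"
    and pairing: "\<exists>C. is_upair a b C"
    and union: "\<exists>U. \<forall>x. x \<^bold>\<in> U \<longleftrightarrow> (\<exists>B. B \<^bold>\<in> A \<and> x \<^bold>\<in> B)"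
    and power_set: "\<exists>P. \<forall>B. B \<^bold>\<in> P \<longleftrightarrow> subset_of B A"
    and infinity: "\<exists>A. is_inductive A"
    and separation: "\<exists>B. \<forall>x. x \<^bold>\<in> B \<longleftrightarrow> x \<^bold>\<in> A \<and> sat (v(0 := x)) \<phi>"
    and replacement:
      "(\<forall>x y z. x \<^bold>\<in> A \<and> sat (v(0 := x, 1 := y)) \<phi> \<and> sat (v(0 := x, 1 := z)) \<phi> \<longrightarrow> y = z)
        \<Longrightarrow> \<exists>B. \<forall>y. y \<^bold>\<in> B \<longleftrightarrow> (\<exists>x. x \<^bold>\<in> A \<and> sat (v(0 := x, 1 := y)) \<phi>)"

end

(* Suppose X has no well-ordering.  By induction on n inside the model, for every set Z there is a
   family F of cardinality n without injections between distinct members, each member of which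
   contains a product X x M where M does not embed in Z.  For the successor step let L be an ordinal
   not embedding in Z, apply the induction hypothesis to the union of Z and X x L to obtain F, let K
   be an ordinal not embedding in the union of F, and add N = (X x L) u K to F.  Because of K, N
   embeds in no member of F.  If X x M embedded in N, then either a fibre {x} x M would embed in
   X x L, or taking least values in K would embed X in K; both are excluded.  The case n = k
   contradicts k-trichotomy.

   The induction and all comprehensions take place in the model, so the predicates concerned have to
   be given by formulas; this is what the predicate definable is for. *)

theory Submission
  imports Defs
begin

section \<open>Definability with parameters\<close>

primrec rename :: "(nat \<Rightarrow> nat) \<Rightarrow> fm \<Rightarrow> fm" where
  "rename r (Mem i j) = Mem (r i) (r j)"
| "rename r (Eq i j) = Eq (r i) (r j)"
| "rename r (Neg \<phi>) = Neg (rename r \<phi>)"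
| "rename r (Conj \<phi> \<psi>) = Conj (rename r \<phi>) (rename r \<psi>)"
| "rename r (Forall i \<phi>) = Forall (r i) (rename r \<phi>)"

text \<open>Variables sit at the even positions and parameters at the odd ones, which leaves room to
  combine the parameters of two formulas.\<close>

definition merge :: "(nat \<Rightarrow> 'a) \<Rightarrow> (nat \<Rightarrow> 'a) \<Rightarrow> nat \<Rightarrow> 'a" where
  "merge w v n = (if even n then v (n div 2) else w (n div 2))"

definition reference :: "((nat \<Rightarrow> 'a) \<Rightarrow> 'a) \<Rightarrow> bool" where
  "reference t \<longleftrightarrow> (\<exists>i. t = (\<lambda>v. v i)) \<or> (\<exists>c. t = (\<lambda>v. c))"

lemma reference_var: "reference (\<lambda>v. v i)"
  by (auto simp: reference_def)

lemma reference_const: "reference (\<lambda>v. c)"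
  by (auto simp: reference_def)

lemma reference_pair:
  assumes "reference s" "reference t"
  obtains i j w where "\<And>v. s v = merge w v i" "\<And>v. t v = merge w v j"
proof -
  have *: "\<exists>i. \<forall>v. s v = merge w v i" if "s = (\<lambda>v. v k)" for s w and k :: nat
    using that by (intro exI[of _ "2 * k"]) (auto simp: merge_def)
  show thesis
  proof (cases "\<exists>c. s = (\<lambda>v. c)")
    case True
    then obtain c where c: "s = (\<lambda>v. c)" by blast
    show thesis
    proof (cases "\<exists>d. t = (\<lambda>v. d)")
      case True
      then obtain d where d: "t = (\<lambda>v. d)" by blast
      show thesis
        \<comment> \<open>Positions 1 and 3 of \<open>merge\<close> read the parameters number 0 and
          1.\<close>
        by (rule that[of "\<lambda>n. if n = 0 then c else d" 1 3]) (auto simp: c d merge_def)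
    next
      case False
      then obtain j where "t = (\<lambda>v. v j)" using assms(2) by (auto simp: reference_def)
      then show thesis
        using c by (intro that[of "\<lambda>n. c" 1 "2 * j"]) (auto simp: merge_def)
    qed
  next
    case False
    then obtain i where i: "s = (\<lambda>v. v i)" using assms(1) by (auto simp: reference_def)
    from assms(2) consider j where "t = (\<lambda>v. v j)" | d where "t = (\<lambda>v. d)"
      by (auto simp: reference_def)
    then show thesis
    proof cases
      case 1
      then show thesis
        using i by (intro that[of _ "2 * i" "2 * j"]) (auto simp: merge_def)
    next
      case 2
      then show thesis
        using i by (intro that[of "\<lambda>n. d" "2 * i" 1]) (auto simp: merge_def)
    qed
  qed
qed

context membership
begin

text \<open>Injectivity rules out capture: updating the renamed bound variable changes the composed
  assignment at one place only.\<close>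

lemma sat_rename: "inj r \<Longrightarrow> sat v (rename r \<phi>) \<longleftrightarrow> sat (v \<circ> r) \<phi>"
proof (induction \<phi> arbitrary: v)
  case (Forall i \<phi>)
  then have "(v(r i := a)) \<circ> r = (v \<circ> r)(i := a)" for a
    by (auto simp: fun_eq_iff inj_eq)
  with Forall show ?case by (simp only: rename.simps sat.simps)
qed auto

text \<open>Taking predicates of whole assignments lets the closure rules below treat any number of
  free variables at once. The parameters \<open>w\<close> are hidden by the existential
  quantifier.\<close>

definition definable :: "((nat \<Rightarrow> 'a) \<Rightarrow> bool) \<Rightarrow> bool" where
  "definable P \<longleftrightarrow> (\<exists>\<phi> w. \<forall>v. P v \<longleftrightarrow> sat (merge w v) \<phi>)"

lemma definable_mem: "reference s \<Longrightarrow> reference t \<Longrightarrow> definable (\<lambda>v. s v \<^bold>\<in> t v)"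
  unfolding definable_def by (erule (1) reference_pair) (metis sat.simps(1))

lemma definable_eq: "reference s \<Longrightarrow> reference t \<Longrightarrow> definable (\<lambda>v. s v = t v)"
  unfolding definable_def by (erule (1) reference_pair) (metis sat.simps(2))

lemma definable_not: "definable P \<Longrightarrow> definable (\<lambda>v. \<not> P v)"
  unfolding definable_def by (metis sat.simps(3))

lemma definable_conj:
  assumes "definable P" "definable Q"
  shows "definable (\<lambda>v. P v \<and> Q v)"
proof -
  obtain \<phi> w \<psi> u where P: "\<And>v. P v \<longleftrightarrow> sat (merge w v) \<phi>" and Q: "\<And>v. Q v \<longleftrightarrow> sat (merge u v) \<psi>"
    using assms unfolding definable_def by blast
  \<comment> \<open>Both renamings fix the variables. Parameter \<open>m\<close> becomes parameter
    \<open>2 * m\<close> under \<open>r\<close> and \<open>2 * m + 1\<close> under \<open>s\<close>,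
    and \<open>x\<close> interleaves \<open>w\<close> and \<open>u\<close> accordingly.\<close>
  define r where "r n = (if even n then n else 4 * (n div 2) + 1)" for n :: nat
  define s where "s n = (if even n then n else 4 * (n div 2) + 3)" for n :: nat
  define x where "x = merge u w"
  have "inj r" "inj s"
    unfolding r_def s_def inj_def by (auto split: if_splits) presburger+
  moreover have "merge x v \<circ> r = merge w v" "merge x v \<circ> s = merge u v" for v
  proof -
    have "(merge x v \<circ> r) n = merge w v n \<and> (merge x v \<circ> s) n = merge u v n" for n
    proof (cases "even n")
      case False
      then obtain m where n: "n = 2 * m + 1" by (rule oddE)
      have "(4 * m + 1) div 2 = 2 * m" "(4 * m + 3) div 2 = 2 * m + 1"
        by presburger+
      then show ?thesis by (simp add: n merge_def r_def s_def x_def)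
    qed (simp add: merge_def r_def s_def)
    then show "merge x v \<circ> r = merge w v" "merge x v \<circ> s = merge u v"
      by (auto simp: fun_eq_iff)
  qed
  ultimately have "P v \<and> Q v \<longleftrightarrow> sat (merge x v) (Conj (rename r \<phi>) (rename s \<psi>))" for v
    by (simp add: sat_rename P Q)
  then show ?thesis unfolding definable_def by blast
qed

text \<open>Bound variables are handled in de Bruijn style, so that the rule has no freshness condition.\<close>

lemma definable_all:
  assumes "definable (\<lambda>v. P (v 0) (\<lambda>n. v (Suc n)))"
  shows "definable (\<lambda>v. \<forall>a. P a v)"
proof -
  obtain \<phi> w where P: "\<And>v. P (v 0) (\<lambda>n. v (Suc n)) \<longleftrightarrow> sat (merge w v) \<phi>"
    using assms unfolding definable_def by blast
  \<comment> \<open>Parameters move up by one to free position 1 for the bound variable, which was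
    variable 0; the other variables move down by one. The \<open>undefined\<close> in
    \<open>x\<close> sits at position 1, where the quantifier overwrites it.\<close>
  define r where "r n = (if n = 0 then 1 else if even n then n - 2 else n + 2)" for n :: nat
  define x where "x = case_nat undefined w"
  have "inj r"
    unfolding r_def inj_def by (auto split: if_splits) presburger+
  moreover have "(merge x v)(1 := a) \<circ> r = merge w (case_nat a v)" for v a
  proof
    fix n
    show "((merge x v)(1 := a) \<circ> r) n = merge w (case_nat a v) n"
    proof (cases "even n")
      case True
      then obtain m where "n = 2 * m" by blast
      then show ?thesis by (cases m) (auto simp: merge_def r_def)
    next
      case False
      then obtain m where "n = Suc (2 * m)" by (metis oddE Suc_eq_plus1)
      then show ?thesis by (auto simp: merge_def r_def x_def)
    qed
  qed
  ultimately have "(\<forall>a. P a v) \<longleftrightarrow> sat (merge x v) (Forall 1 (rename r \<phi>))" for v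
    using P[of "case_nat _ v"] by (simp add: sat_rename)
  then show ?thesis unfolding definable_def by blast
qed

lemma definable_imp: "definable P \<Longrightarrow> definable Q \<Longrightarrow> definable (\<lambda>v. P v \<longrightarrow> Q v)"
  using definable_not[OF definable_conj[OF _ definable_not, of P Q]] by simp

lemma definable_disj: "definable P \<Longrightarrow> definable Q \<Longrightarrow> definable (\<lambda>v. P v \<or> Q v)"
  using definable_imp[OF definable_not, of P Q] by (simp add: disj_imp)

lemma definable_iff: "definable P \<Longrightarrow> definable Q \<Longrightarrow> definable (\<lambda>v. P v \<longleftrightarrow> Q v)"
  using definable_conj[OF definable_imp definable_imp, of P Q Q P] by (simp add: iff_conv_conj_imp)

lemma definable_ex:
  "definable (\<lambda>v. P (v 0) (\<lambda>n. v (Suc n))) \<Longrightarrow> definable (\<lambda>v. \<exists>a. P a v)"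
  using definable_not[OF definable_all[of "\<lambda>a v. \<not> P a v"]] by (simp add: definable_not)

text \<open>After predicates are unfolded to membership, equality, connectives and quantifiers,
  these rules prove definability without any formula being written down.\<close>

lemmas definable_intros =
  definable_mem definable_eq definable_not definable_conj definable_disj definable_imp
  definable_iff definable_all definable_ex reference_var reference_const

lemmas language_defs =
  subset_of_def is_empty_def is_upair_def is_pair_def is_succ_def related_def is_relation_def
  is_map_def is_injection_def is_bijection_def equinumerous_def contains_injective_def Ex1_def

abbreviation embeds :: "'a \<Rightarrow> 'a \<Rightarrow> bool" where
  "embeds A B \<equiv> \<exists>f. is_injection f A B"

definition transitive :: "'a \<Rightarrow> bool" where
  "transitive A \<longleftrightarrow> (\<forall>x y. x \<^bold>\<in> A \<and> y \<^bold>\<in> x \<longrightarrow> y \<^bold>\<in> A)"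

text \<open>Von Neumann ordinals. Well-foundedness of membership comes from the axiom of foundation,
  so only transitivity and linearity are stated.\<close>

definition is_ordinal :: "'a \<Rightarrow> bool" where
  "is_ordinal A \<longleftrightarrow> transitive A \<and> (\<forall>x. x \<^bold>\<in> A \<longrightarrow> transitive x) \<and>
     (\<forall>x y. x \<^bold>\<in> A \<and> y \<^bold>\<in> A \<longrightarrow> x \<^bold>\<in> y \<or> x = y \<or> y \<^bold>\<in> x)"

end

context ZF_model
begin

section \<open>The axiom schemas for definable predicates\<close>

lemma separation_definable:
  assumes "definable (\<lambda>v. Q (v 0))"
  shows "\<exists>B. \<forall>x. x \<^bold>\<in> B \<longleftrightarrow> x \<^bold>\<in> A \<and> Q x"
proof -
  obtain \<phi> w where Q: "\<And>v. Q (v 0) \<longleftrightarrow> sat (merge w v) \<phi>"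
    using assms unfolding definable_def by blast
  have "(merge w undefined)(0 := x) = merge w (undefined(0 := x))" for x
    by (auto simp: fun_eq_iff merge_def)
  then have "sat ((merge w undefined)(0 := x)) \<phi> \<longleftrightarrow> Q x" for x
    using Q[of "undefined(0 := x)"] by simp
  then show ?thesis using separation[of A "merge w undefined" \<phi>] by simp
qed

lemma replacement_definable:
  assumes "definable (\<lambda>v. R (v 0) (v 1))"
    and "\<And>x y z. x \<^bold>\<in> A \<Longrightarrow> R x y \<Longrightarrow> R x z \<Longrightarrow> y = z"
  shows "\<exists>B. \<forall>y. y \<^bold>\<in> B \<longleftrightarrow> (\<exists>x. x \<^bold>\<in> A \<and> R x y)"
proof -
  obtain \<phi> w where R: "\<And>v. R (v 0) (v 1) \<longleftrightarrow> sat (merge w v) \<phi>"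
    using assms(1) unfolding definable_def by blast
  \<comment> \<open>The schema has its second argument at position 1, while \<open>merge\<close>
    keeps variable 1 at position 2; \<open>r\<close> swaps the two.\<close>
  define r where "r n = (if n = 1 then 2 else if n = 2 then 1 else n)" for n :: nat
  have "inj r" by (auto simp: r_def inj_def)
  have "((merge w undefined \<circ> r)(0 := x, 1 := y)) \<circ> r = merge w (undefined(0 := x, 1 := y))" for x y
    by (auto simp: fun_eq_iff merge_def r_def)
  then have "sat ((merge w undefined \<circ> r)(0 := x, 1 := y)) (rename r \<phi>) \<longleftrightarrow> R x y" for x y
    using R[of "undefined(0 := x, 1 := y)"] by (simp add: sat_rename[OF \<open>inj r\<close>])
  then show ?thesis
    using replacement[of A "merge w undefined \<circ> r" "rename r \<phi>"] assms(2) by simp blast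
qed

section \<open>Pairs, relations and injections\<close>

text \<open>Foundation applied to the singleton of \<open>x\<close>.\<close>

lemma not_mem_self: "\<not> x \<^bold>\<in> x"
  by (metis foundation is_upair_def pairing)

lemma pair_exists: "\<exists>p. is_pair a b p"
  unfolding is_pair_def using pairing by metis

lemma upair_unique: "is_upair a b C \<Longrightarrow> is_upair a b D \<Longrightarrow> C = D"
  unfolding is_upair_def by (metis extensionality)

lemma pair_unique: "is_pair a b p \<Longrightarrow> is_pair a b q \<Longrightarrow> p = q"
  unfolding is_pair_def by (metis upair_unique)

lemma pair_inject:
  assumes "is_pair a b p" "is_pair c d p"
  shows "a = c \<and> b = d"
proof -
  obtain s t where st: "is_upair a a s" "is_upair a b t" "is_upair s t p"
    using assms(1) unfolding is_pair_def by blast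
  obtain s' t' where st': "is_upair c c s'" "is_upair c d t'" "is_upair s' t' p"
    using assms(2) unfolding is_pair_def by blast
  have e: "s = s' \<and> t = t' \<or> s = t' \<and> t = s'"
    using st(3) st'(3) unfolding is_upair_def by metis
  have "a = c"
    using e st st' unfolding is_upair_def by metis
  moreover have "b = d"
    using e st st' calculation unfolding is_upair_def by metis
  ultimately show ?thesis ..
qed

lemma union_exists: "\<exists>U. \<forall>x. x \<^bold>\<in> U \<longleftrightarrow> x \<^bold>\<in> A \<or> x \<^bold>\<in> B"
proof -
  obtain C where "is_upair A B C" using pairing by blast
  then show ?thesis using union[of C] unfolding is_upair_def by metis
qed

lemma insert_exists: "\<exists>U. \<forall>x. x \<^bold>\<in> U \<longleftrightarrow> x \<^bold>\<in> A \<or> x = a"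
proof -
  obtain C where "is_upair a a C" using pairing by blast
  then show ?thesis using union_exists[of A C] unfolding is_upair_def by metis
qed

text \<open>Kuratowski pairs lie in the double power set of the union of \<open>A\<close> and
  \<open>B\<close>, from which the product is separated.\<close>

lemma product_exists: "\<exists>P. \<forall>p. p \<^bold>\<in> P \<longleftrightarrow> (\<exists>a b. a \<^bold>\<in> A \<and> b \<^bold>\<in> B \<and> is_pair a b p)"
proof -
  obtain U where U: "\<And>x. x \<^bold>\<in> U \<longleftrightarrow> x \<^bold>\<in> A \<or> x \<^bold>\<in> B" using union_exists by metis
  obtain V where V: "\<And>x. x \<^bold>\<in> V \<longleftrightarrow> subset_of x U" using power_set by metis
  obtain W where W: "\<And>x. x \<^bold>\<in> W \<longleftrightarrow> subset_of x V" using power_set by metis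
  have "p \<^bold>\<in> W" if "a \<^bold>\<in> A" "b \<^bold>\<in> B" "is_pair a b p" for a b p
    using that unfolding W V U is_pair_def is_upair_def subset_of_def by (metis U)
  moreover have "\<exists>P. \<forall>p. p \<^bold>\<in> P \<longleftrightarrow> p \<^bold>\<in> W \<and> (\<exists>a b. a \<^bold>\<in> A \<and> b \<^bold>\<in> B \<and> is_pair a b p)"
    by (rule separation_definable, unfold language_defs) (intro definable_intros)
  ultimately show ?thesis by metis
qed

text \<open>The hypothesis ranges over all variable positions \<open>i\<close> and \<open>j\<close>
  because \<open>R\<close> is used beneath quantifiers, which shift the positions.\<close>

lemma relation_exists:
  assumes "\<And>i j. definable (\<lambda>v. R (v i) (v j))"
  shows "\<exists>r. is_relation r A B \<and> (\<forall>a b. related r a b \<longleftrightarrow> a \<^bold>\<in> A \<and> b \<^bold>\<in> B \<and> R a b)"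
proof -
  obtain P where P: "\<And>p. p \<^bold>\<in> P \<longleftrightarrow> (\<exists>a b. a \<^bold>\<in> A \<and> b \<^bold>\<in> B \<and> is_pair a b p)"
    using product_exists by metis
  have "\<exists>r. \<forall>p. p \<^bold>\<in> r \<longleftrightarrow> p \<^bold>\<in> P \<and> (\<exists>a b. is_pair a b p \<and> R a b)"
    by (rule separation_definable, unfold language_defs) (intro definable_intros assms)
  then show ?thesis
    unfolding is_relation_def related_def by (metis P pair_exists pair_inject)
qed

text \<open>The common tool for building injections. The graph is kept in the conclusion for cases
  such as \<open>equinumerous_insert\<close>, where surjectivity must be checked afterwards.\<close>

lemma injection_exists:
  assumes "\<And>i j. definable (\<lambda>v. R (v i) (v j))"
    and "\<And>a. a \<^bold>\<in> A \<Longrightarrow> \<exists>b. b \<^bold>\<in> B \<and> R a b"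
    and "\<And>a b c. a \<^bold>\<in> A \<Longrightarrow> b \<^bold>\<in> B \<Longrightarrow> c \<^bold>\<in> B \<Longrightarrow> R a b \<Longrightarrow> R a c \<Longrightarrow> b = c"
    and "\<And>a a' b. a \<^bold>\<in> A \<Longrightarrow> a' \<^bold>\<in> A \<Longrightarrow> b \<^bold>\<in> B \<Longrightarrow> R a b \<Longrightarrow> R a' b \<Longrightarrow> a = a'"
  shows "\<exists>f. is_injection f A B \<and> (\<forall>a b. related f a b \<longleftrightarrow> a \<^bold>\<in> A \<and> b \<^bold>\<in> B \<and> R a b)"
proof -
  obtain f where f: "is_relation f A B"
    "\<And>a b. related f a b \<longleftrightarrow> a \<^bold>\<in> A \<and> b \<^bold>\<in> B \<and> R a b"
    using relation_exists[of R A B, OF assms(1)] by blast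
  have "is_injection f A B"
    unfolding is_injection_def is_map_def using f(1)
    by (auto simp: f(2) intro: assms(4)) (metis assms(2), metis assms(3))
  with f show ?thesis by blast
qed

lemma related_mem: "is_relation r A B \<Longrightarrow> related r a b \<Longrightarrow> a \<^bold>\<in> A \<and> b \<^bold>\<in> B"
  unfolding is_relation_def related_def by (metis pair_inject)

lemma injection_mem: "is_injection f A B \<Longrightarrow> related f a b \<Longrightarrow> a \<^bold>\<in> A \<and> b \<^bold>\<in> B"
  unfolding is_injection_def is_map_def by (metis related_mem)

lemma injection_total: "is_injection f A B \<Longrightarrow> a \<^bold>\<in> A \<Longrightarrow> \<exists>b. related f a b"
  unfolding is_injection_def is_map_def by blast

lemma injection_functional: "is_injection f A B \<Longrightarrow> related f a b \<Longrightarrow> related f a c \<Longrightarrow> b = c"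
  using injection_mem unfolding is_injection_def is_map_def by blast

lemma injection_injective: "is_injection f A B \<Longrightarrow> related f a b \<Longrightarrow> related f a' b \<Longrightarrow> a = a'"
  unfolding is_injection_def by blast

lemmas injectionD = injection_mem injection_total injection_functional injection_injective

section \<open>Restricting and extending injections\<close>

lemma embeds_mono:
  assumes f: "is_injection f A B" and "subset_of A' A" "subset_of B B'"
  shows "embeds A' B'"
proof -
  have "\<exists>g. is_injection g A' B' \<and> (\<forall>a b. related g a b \<longleftrightarrow> a \<^bold>\<in> A' \<and> b \<^bold>\<in> B' \<and> related f a b)"
  proof (rule injection_exists)
    show "definable (\<lambda>v. related f (v i) (v j))" for i j
      unfolding language_defs by (intro definable_intros)
  qed (use assms injectionD[OF f] in \<open>unfold subset_of_def, metis+\<close>)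
  then show ?thesis by blast
qed

lemma embeds_subset:
  assumes "subset_of A B"
  shows "embeds A B"
proof -
  have "\<exists>g. is_injection g A B \<and> (\<forall>a b. related g a b \<longleftrightarrow> a \<^bold>\<in> A \<and> b \<^bold>\<in> B \<and> a = b)"
    by (rule injection_exists, intro definable_intros) (use assms in \<open>auto simp: subset_of_def\<close>)
  then show ?thesis by blast
qed

text \<open>The bijection is extended by sending \<open>a\<close> to \<open>n\<close>; this value is
  new because \<open>n\<close> is not a member of itself.\<close>

lemma equinumerous_insert:
  assumes "equinumerous F n" "\<not> a \<^bold>\<in> F" "\<And>x. x \<^bold>\<in> G \<longleftrightarrow> x \<^bold>\<in> F \<or> x = a" "is_succ n m"
  shows "equinumerous G m"
proof -
  obtain f where f: "is_injection f F n" "\<And>y. y \<^bold>\<in> n \<Longrightarrow> \<exists>x. related f x y"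
    using assms(1) unfolding equinumerous_def is_bijection_def by blast
  have m: "y \<^bold>\<in> m \<longleftrightarrow> y \<^bold>\<in> n \<or> y = n" for y
    using assms(4) by (simp add: is_succ_def)
  let ?R = "\<lambda>x y. related f x y \<or> x = a \<and> y = n"
  have "\<exists>g. is_injection g G m \<and> (\<forall>x y. related g x y \<longleftrightarrow> x \<^bold>\<in> G \<and> y \<^bold>\<in> m \<and> ?R x y)"
  proof (rule injection_exists)
    show "definable (\<lambda>v. ?R (v i) (v j))" for i j
      unfolding language_defs by (intro definable_intros)
  qed (unfold assms(3) m; metis assms(2) injectionD[OF f(1)] not_mem_self)+
  then obtain g where g: "is_injection g G m"
    "\<And>x y. related g x y \<longleftrightarrow> x \<^bold>\<in> G \<and> y \<^bold>\<in> m \<and> ?R x y" by blast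
  have "\<exists>x. related g x y" if "y \<^bold>\<in> m" for y
    using that unfolding g(2) m by (metis assms(3) f injection_mem)
  with g(1) show ?thesis
    unfolding equinumerous_def is_bijection_def by blast
qed

section \<open>Ordinals and Hartogs' theorem\<close>

lemma transitiveD: "transitive A \<Longrightarrow> x \<^bold>\<in> A \<Longrightarrow> y \<^bold>\<in> x \<Longrightarrow> y \<^bold>\<in> A"
  unfolding transitive_def by blast

lemma ordinal_transitive: "is_ordinal A \<Longrightarrow> transitive A"
  unfolding is_ordinal_def by blast

lemma ordinal_elem:
  assumes "is_ordinal A" "x \<^bold>\<in> A"
  shows "is_ordinal x"
proof -
  have A: "y \<^bold>\<in> A" if "y \<^bold>\<in> x" for y
    using transitiveD[OF ordinal_transitive] assms that by blast
  have "transitive x"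
    using assms by (simp add: is_ordinal_def)
  moreover have "transitive y" if "y \<^bold>\<in> x" for y
    using assms(1) A[OF that] by (simp add: is_ordinal_def)
  moreover have "y \<^bold>\<in> z \<or> y = z \<or> z \<^bold>\<in> y" if "y \<^bold>\<in> x" "z \<^bold>\<in> x" for y z
    using assms(1) A that unfolding is_ordinal_def by blast
  ultimately show ?thesis unfolding is_ordinal_def by blast
qed

text \<open>If \<open>C\<close> is not all of \<open>A\<close>, a membership-minimal element of
  \<open>A\<close> outside \<open>C\<close> has exactly the elements of \<open>C\<close>.\<close>

lemma transitive_subset_ordinal:
  assumes A: "is_ordinal A" and C: "transitive C" "subset_of C A"
  shows "C = A \<or> C \<^bold>\<in> A"
proof (cases "\<exists>x. x \<^bold>\<in> A \<and> \<not> x \<^bold>\<in> C")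
  case True
  have "\<exists>D. \<forall>x. x \<^bold>\<in> D \<longleftrightarrow> x \<^bold>\<in> A \<and> \<not> x \<^bold>\<in> C"
    by (rule separation_definable) (intro definable_intros)
  then obtain m where m: "m \<^bold>\<in> A" "\<not> m \<^bold>\<in> C" "\<And>y. y \<^bold>\<in> A \<Longrightarrow> \<not> y \<^bold>\<in> C \<Longrightarrow> \<not> y \<^bold>\<in> m"
    using True foundation by metis
  have "x \<^bold>\<in> m \<longleftrightarrow> x \<^bold>\<in> C" for x
    using A C m unfolding is_ordinal_def transitive_def subset_of_def by metis
  then have "m = C" by (rule extensionality[OF allI])
  with m show ?thesis by blast
next
  case False
  then have "C = A" using C by (intro extensionality) (auto simp: subset_of_def)
  then show ?thesis ..
qed

text \<open>The intersection \<open>C\<close> is a transitive subset of both ordinals. It cannot be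
  an element of both, since it would then be an element of itself.\<close>

lemma ordinal_linear:
  assumes "is_ordinal A" "is_ordinal B"
  shows "A \<^bold>\<in> B \<or> A = B \<or> B \<^bold>\<in> A"
proof -
  have "\<exists>C. \<forall>x. x \<^bold>\<in> C \<longleftrightarrow> x \<^bold>\<in> A \<and> x \<^bold>\<in> B"
    by (rule separation_definable) (intro definable_intros)
  then obtain C where C: "\<And>x. x \<^bold>\<in> C \<longleftrightarrow> x \<^bold>\<in> A \<and> x \<^bold>\<in> B" by blast
  have "transitive C" "subset_of C A" "subset_of C B"
    unfolding transitive_def[of C] subset_of_def C
    using assms[THEN ordinal_transitive] transitiveD by blast+
  then have "C = A \<or> C \<^bold>\<in> A" "C = B \<or> C \<^bold>\<in> B"
    using transitive_subset_ordinal assms by blast+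
  then show ?thesis
    using C[of C] not_mem_self[of C] by auto
qed

text \<open>The reflexive form of the induced order is used because its field is the whole image,
  even when the ordinal has only one element.\<close>

definition codes :: "'a \<Rightarrow> 'a \<Rightarrow> 'a \<Rightarrow> bool" where
  "codes f A r \<longleftrightarrow> (\<forall>x y. related r x y \<longleftrightarrow>
     (\<exists>a b. b \<^bold>\<in> A \<and> (a \<^bold>\<in> b \<or> a = b) \<and> related f a x \<and> related f b y))"

lemma codes_below:
  assumes "is_injection f A Z" "codes f A r" "a \<^bold>\<in> A" "related f a x"
  shows "related r y x \<longleftrightarrow> (\<exists>b. (b \<^bold>\<in> a \<or> b = a) \<and> related f b y)"
proof -
  have "related r y x \<longleftrightarrow>
    (\<exists>b a'. a' \<^bold>\<in> A \<and> (b \<^bold>\<in> a' \<or> b = a') \<and> related f b y \<and> related f a' x)"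
    using assms(2) unfolding codes_def by blast
  moreover have "related f a' x \<longleftrightarrow> a' = a" for a'
    using assms(4) injection_injective[OF assms(1)] by blast
  ultimately show ?thesis using assms(3) by simp
qed

text \<open>The maps \<open>f\<close> and \<open>g\<close> agree on \<open>A\<close>. At a minimal
  failure \<open>a\<close>, the value \<open>x\<close> of \<open>f\<close> is also the value of
  \<open>g\<close> at some \<open>c\<close>, and comparing the \<open>r\<close>-predecessors of
  \<open>x\<close> on both sides yields \<open>a = c\<close>.\<close>

lemma codes_subset:
  assumes A: "is_ordinal A" and f: "is_injection f A Z" "codes f A r"
    and B: "is_ordinal B" and g: "is_injection g B Z" "codes g B r"
  shows "subset_of A B"
proof (rule ccontr)
  let ?ok = "\<lambda>a. a \<^bold>\<in> B \<and> (\<exists>x. related f a x \<and> related g a x)"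
  assume "\<not> subset_of A B"
  then have "\<exists>a. a \<^bold>\<in> A \<and> \<not> ?ok a" unfolding subset_of_def by blast
  moreover have "\<exists>D. \<forall>a. a \<^bold>\<in> D \<longleftrightarrow> a \<^bold>\<in> A \<and> \<not> ?ok a"
    by (rule separation_definable, unfold language_defs) (intro definable_intros)
  ultimately obtain a where a: "a \<^bold>\<in> A" "\<not> ?ok a"
    and min: "\<And>b. b \<^bold>\<in> A \<Longrightarrow> \<not> ?ok b \<Longrightarrow> \<not> b \<^bold>\<in> a"
    using foundation by metis
  have below: "?ok b" if "b \<^bold>\<in> a" for b
    using that min a A unfolding is_ordinal_def transitive_def by metis
  obtain x where x: "related f a x" using a f injection_total by metis
  \<comment> \<open>Reflexivity of the coded order is what puts \<open>x\<close> into the image of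
    \<open>g\<close>.\<close>
  then have "related r x x" using f(2) a unfolding codes_def by metis
  then obtain c where c: "c \<^bold>\<in> B" "related g c x"
    using g(2) unfolding codes_def by metis
  note fr = codes_below[OF f a(1) x] and gr = codes_below[OF g c]
  have "b \<^bold>\<in> c" if b: "b \<^bold>\<in> a" for b
  proof -
    obtain y where y: "related f b y" "related g b y" using below b by blast
    then have "related r y x" using fr b by blast
    then obtain b' where "b' \<^bold>\<in> c \<or> b' = c" "related g b' y" using gr by blast
    then have "b \<^bold>\<in> c \<or> b = c" using y g by (metis injection_injective)
    \<comment> \<open>If \<open>b = c\<close>, then \<open>y = x\<close> since \<open>g\<close> is a
      function, so \<open>b = a\<close> by injectivity of \<open>f\<close>, against \<open>b\<close>
      being an element of \<open>a\<close>.\<close>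
    moreover have "b \<noteq> c"
      using y c x f g b not_mem_self by (metis injection_injective injection_functional)
    ultimately show ?thesis by blast
  qed
  moreover have "b \<^bold>\<in> a" if b: "b \<^bold>\<in> c" for b
  proof -
    have "b \<^bold>\<in> B" using b c B unfolding is_ordinal_def transitive_def by metis
    then obtain y where y: "related g b y" using g injection_total by metis
    then have "related r y x" using gr b by blast
    then obtain b' where b': "b' \<^bold>\<in> a \<or> b' = a" "related f b' y" using fr by blast
    have "b' \<noteq> a"
      using b' x y c g f b not_mem_self by (metis injection_injective injection_functional)
    with b' have "b' \<^bold>\<in> a" by blast
    then have "b' = b" using below b' y f g by (metis injection_injective injection_functional)
    with \<open>b' \<^bold>\<in> a\<close> show ?thesis by simp
  qed
  ultimately have "a = c" by (intro extensionality) blast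
  with a x c show False by blast
qed

lemma codes_unique:
  assumes "is_ordinal A" "is_injection f A Z" "codes f A r"
    and "is_ordinal B" "is_injection g B Z" "codes g B r"
  shows "A = B"
  using codes_subset[OF assms] codes_subset[OF assms(4-6) assms(1-3)]
  by (intro extensionality) (auto simp: subset_of_def)

text \<open>\<open>H\<close> consists of all ordinals embedding in \<open>Z\<close>. It is a set by
  replacement over the relations on \<open>Z\<close>, each of which codes at most one ordinal. It is
  itself an ordinal, so an embedding into \<open>Z\<close> would make it its own element.\<close>

lemma hartogs: "\<exists>H. is_ordinal H \<and> \<not> embeds H Z"
proof -
  obtain P where P: "\<And>p. p \<^bold>\<in> P \<longleftrightarrow> (\<exists>a b. a \<^bold>\<in> Z \<and> b \<^bold>\<in> Z \<and> is_pair a b p)"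
    using product_exists by metis
  obtain W where W: "\<And>r. r \<^bold>\<in> W \<longleftrightarrow> subset_of r P" using power_set by metis
  let ?R = "\<lambda>r A. is_ordinal A \<and> (\<exists>f. is_injection f A Z \<and> codes f A r)"
  have "\<exists>H. \<forall>A. A \<^bold>\<in> H \<longleftrightarrow> (\<exists>r. r \<^bold>\<in> W \<and> ?R r A)"
  proof (rule replacement_definable)
    show "definable (\<lambda>v. ?R (v 0) (v 1))"
      unfolding language_defs is_ordinal_def transitive_def codes_def by (intro definable_intros)
  qed (metis codes_unique)
  then obtain H where H: "\<And>A. A \<^bold>\<in> H \<longleftrightarrow> (\<exists>r. r \<^bold>\<in> W \<and> ?R r A)" by blast
  have "\<exists>r. r \<^bold>\<in> W \<and> codes f A r" if A: "is_ordinal A" and f: "is_injection f A Z" for A f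
  proof -
    let ?C = "\<lambda>x y. \<exists>a b. b \<^bold>\<in> A \<and> (a \<^bold>\<in> b \<or> a = b) \<and> related f a x \<and> related f b y"
    have "\<exists>r. is_relation r Z Z \<and> (\<forall>x y. related r x y \<longleftrightarrow> x \<^bold>\<in> Z \<and> y \<^bold>\<in> Z \<and> ?C x y)"
      by (rule relation_exists, unfold language_defs) (intro definable_intros)
    then obtain r where r: "is_relation r Z Z"
      "\<And>x y. related r x y \<longleftrightarrow> x \<^bold>\<in> Z \<and> y \<^bold>\<in> Z \<and> ?C x y" by blast
    have "r \<^bold>\<in> W"
      using r(1) unfolding W subset_of_def P is_relation_def by blast
    moreover have "codes f A r"
      unfolding codes_def r(2) using injection_mem[OF f] by blast
    ultimately show ?thesis by blast
  qed
  then have H: "A \<^bold>\<in> H \<longleftrightarrow> is_ordinal A \<and> embeds A Z" for A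
    unfolding H by blast
  have "transitive H"
    unfolding transitive_def
  proof (intro allI impI, elim conjE)
    fix A B
    assume "A \<^bold>\<in> H" "B \<^bold>\<in> A"
    then have "is_ordinal A" "is_ordinal B" "embeds A Z"
      unfolding H by (auto intro: ordinal_elem)
    moreover have "subset_of B A"
      using \<open>is_ordinal A\<close> \<open>B \<^bold>\<in> A\<close> ordinal_transitive transitiveD
      unfolding subset_of_def by blast
    ultimately show "B \<^bold>\<in> H"
      unfolding H using embeds_mono[of _ A Z B Z] by (auto simp: subset_of_def[of Z])
  qed
  then have "is_ordinal H"
    using H ordinal_linear unfolding is_ordinal_def[of H] by (simp add: is_ordinal_def)
  then show ?thesis using H not_mem_self by blast
qed

section \<open>Least elements of ordinals and induced well-orderings\<close>

lemma ordinal_minimum: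
  assumes K: "is_ordinal K" and def: "definable (\<lambda>v. Q (v 0))" and "b \<^bold>\<in> K" "Q b"
  shows "\<exists>m. m \<^bold>\<in> K \<and> Q m \<and> (\<forall>y. y \<^bold>\<in> K \<and> Q y \<longrightarrow> y = m \<or> m \<^bold>\<in> y)"
proof -
  obtain D where "\<And>x. x \<^bold>\<in> D \<longleftrightarrow> x \<^bold>\<in> K \<and> Q x"
    using separation_definable[OF def] by metis
  then have "\<exists>m. m \<^bold>\<in> K \<and> Q m \<and> (\<forall>y. y \<^bold>\<in> K \<and> Q y \<longrightarrow> \<not> y \<^bold>\<in> m)"
    using foundation[of b D] assms by blast
  \<comment> \<open>Linearity of membership on \<open>K\<close> turns the minimal element into a
    least one.\<close>
  then show ?thesis using K unfolding is_ordinal_def by blast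
qed

text \<open>Membership on \<open>K\<close> is pulled back along \<open>f\<close>. Used
  contrapositively: a set without a well-ordering embeds in no ordinal.\<close>

lemma well_ordering_of_embedding:
  assumes K: "is_ordinal K" and f: "is_injection f X K"
  shows "\<exists>r. is_well_ordering r X"
proof -
  let ?R = "\<lambda>x y. \<exists>a b. related f x a \<and> related f y b \<and> a \<^bold>\<in> b"
  have "\<exists>r. is_relation r X X \<and> (\<forall>x y. related r x y \<longleftrightarrow> x \<^bold>\<in> X \<and> y \<^bold>\<in> X \<and> ?R x y)"
    by (rule relation_exists, unfold language_defs) (intro definable_intros)
  then obtain r where r: "is_relation r X X"
    and "\<And>x y. related r x y \<longleftrightarrow> x \<^bold>\<in> X \<and> y \<^bold>\<in> X \<and> ?R x y" by blast
  then have rel: "related r x y \<longleftrightarrow> ?R x y" for x y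
    using injection_mem[OF f] by blast
  have "\<exists>m. m \<^bold>\<in> S \<and> (\<forall>x. x \<^bold>\<in> S \<longrightarrow> x = m \<or> related r m x)"
    if S: "subset_of S X" "\<not> is_empty S" for S
  proof -
    let ?Q = "\<lambda>a. \<exists>x. x \<^bold>\<in> S \<and> related f x a"
    obtain x b where "x \<^bold>\<in> S" "related f x b" "b \<^bold>\<in> K"
      using S injectionD(1,2)[OF f] unfolding subset_of_def is_empty_def by metis
    moreover have "definable (\<lambda>v. ?Q (v 0))"
      unfolding language_defs by (intro definable_intros)
    ultimately have "\<exists>m. m \<^bold>\<in> K \<and> ?Q m \<and> (\<forall>y. y \<^bold>\<in> K \<and> ?Q y \<longrightarrow> y = m \<or> m \<^bold>\<in> y)"
      by (intro ordinal_minimum[OF K]) blast+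
    then obtain a m where m: "m \<^bold>\<in> S" "related f m a"
      and min: "\<And>y. y \<^bold>\<in> K \<Longrightarrow> ?Q y \<Longrightarrow> y = a \<or> a \<^bold>\<in> y" by blast
    have "x = m \<or> related r m x" if "x \<^bold>\<in> S" for x
    proof -
      obtain y where "related f x y" "y \<^bold>\<in> K"
        using \<open>x \<^bold>\<in> S\<close> S injectionD(1,2)[OF f] unfolding subset_of_def by metis
      then show ?thesis
        using that min m unfolding rel by (metis injection_injective[OF f])
    qed
    with m show ?thesis by blast
  qed
  moreover have "x = y \<or> related r x y \<or> related r y x" if "x \<^bold>\<in> X" "y \<^bold>\<in> X" for x y
  proof -
    obtain a b where "related f x a" "related f y b" "a \<^bold>\<in> K" "b \<^bold>\<in> K"
      using \<open>x \<^bold>\<in> X\<close> \<open>y \<^bold>\<in> X\<close> injectionD(1,2)[OF f] by metis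
    then show ?thesis
      using K unfolding rel is_ordinal_def by (metis injection_injective[OF f])
  qed
  moreover have "\<not> related r x x" for x
    unfolding rel by (metis injection_functional[OF f] not_mem_self)
  moreover have "related r x z" if xyz: "related r x y" "related r y z" for x y z
  proof -
    obtain a b c where "related f x a" "related f y b" "related f z c" "a \<^bold>\<in> b" "b \<^bold>\<in> c" "c \<^bold>\<in> K"
      using xyz unfolding rel by (metis injection_functional[OF f] injection_mem[OF f])
    then show ?thesis
      using K unfolding rel is_ordinal_def transitive_def by blast
  qed
  ultimately show ?thesis
    unfolding is_well_ordering_def using r by blast
qed

section \<open>Incomparable families\<close>

text \<open>Inclusion of the product in \<open>A\<close>, phrased without naming the product
  set.\<close>

definition contains_product :: "'a \<Rightarrow> 'a \<Rightarrow> 'a \<Rightarrow> bool" where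
  "contains_product X M A \<longleftrightarrow>
     (\<forall>x m. x \<^bold>\<in> X \<and> m \<^bold>\<in> M \<longrightarrow> (\<exists>p. p \<^bold>\<in> A \<and> is_pair x m p))"

text \<open>Either some fibre of \<open>X \<times> M\<close> is mapped into \<open>P\<close>, or every fibre meets \<open>K\<close>, and then an element
  of \<open>X\<close> can be sent to the least value in \<open>K\<close> taken on its fibre.\<close>

lemma embeds_product_union:
  assumes A: "contains_product X M A" and g: "is_injection g A N" and K: "is_ordinal K"
    and N: "\<And>x. x \<^bold>\<in> N \<longleftrightarrow> x \<^bold>\<in> P \<or> x \<^bold>\<in> K"
  shows "embeds M P \<or> embeds X K"
proof -
  let ?Q = "\<lambda>x b. \<exists>m p. m \<^bold>\<in> M \<and> is_pair x m p \<and> related g p b"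
  show ?thesis
  proof (cases "\<exists>x. x \<^bold>\<in> X \<and> (\<forall>b. ?Q x b \<longrightarrow> \<not> b \<^bold>\<in> K)")
    case True
    then obtain x where x: "x \<^bold>\<in> X" "\<And>b. ?Q x b \<Longrightarrow> \<not> b \<^bold>\<in> K" by blast
    let ?R = "\<lambda>m b. \<exists>p. is_pair x m p \<and> related g p b"
    have "\<exists>h. is_injection h M P \<and> (\<forall>m b. related h m b \<longleftrightarrow> m \<^bold>\<in> M \<and> b \<^bold>\<in> P \<and> ?R m b)"
    proof (rule injection_exists)
      show "definable (\<lambda>v. ?R (v i) (v j))" for i j
        unfolding language_defs by (intro definable_intros)
      show "\<exists>b. b \<^bold>\<in> P \<and> ?R m b" if "m \<^bold>\<in> M" for m
      proof -
        obtain p where p: "p \<^bold>\<in> A" "is_pair x m p"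
          using A x \<open>m \<^bold>\<in> M\<close> unfolding contains_product_def by blast
        then obtain b where "related g p b" "b \<^bold>\<in> N" using injectionD(1,2)[OF g] by metis
        with p x(2) N that show ?thesis by blast
      qed
      show "b = c" if "?R m b" "?R m c" for m b c
        using that by (metis injection_functional[OF g] pair_unique)
      show "m = m'" if "?R m b" "?R m' b" for m m' b
        using that by (metis injection_injective[OF g] pair_inject)
    qed
    then show ?thesis by blast
  next
    case False
    let ?R = "\<lambda>x b. ?Q x b \<and> (\<forall>c. c \<^bold>\<in> K \<and> ?Q x c \<longrightarrow> c = b \<or> b \<^bold>\<in> c)"
    have "\<exists>h. is_injection h X K \<and> (\<forall>x b. related h x b \<longleftrightarrow> x \<^bold>\<in> X \<and> b \<^bold>\<in> K \<and> ?R x b)"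
    proof (rule injection_exists)
      show "definable (\<lambda>v. ?R (v i) (v j))" for i j
        unfolding language_defs by (intro definable_intros)
      show "\<exists>b. b \<^bold>\<in> K \<and> ?R x b" if "x \<^bold>\<in> X" for x
      proof -
        obtain b where b: "b \<^bold>\<in> K" "?Q x b" using False \<open>x \<^bold>\<in> X\<close> by blast
        have "definable (\<lambda>v. ?Q x (v 0))"
          unfolding language_defs by (intro definable_intros)
        from ordinal_minimum[OF K this b] show ?thesis .
      qed
      show "b = c" if "b \<^bold>\<in> K" "c \<^bold>\<in> K" "?R x b" "?R x c" for x b c
      proof (rule ccontr)
        assume "b \<noteq> c"
        then have "b \<^bold>\<in> c" "c \<^bold>\<in> b" using that by blast+
        then have "b \<^bold>\<in> b"
          using K \<open>b \<^bold>\<in> K\<close> unfolding is_ordinal_def transitive_def by blast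
        then show False using not_mem_self by blast
      qed
      \<comment> \<open>By injectivity of \<open>g\<close> the value \<open>b\<close> comes from a
        single pair, whose first component is both \<open>x\<close> and \<open>y\<close>.\<close>
      show "x = y" if "?R x b" "?R y b" for x y b
        using that by (metis injection_injective[OF g] pair_inject)
    qed
    then show ?thesis by blast
  qed
qed

text \<open>The induction invariant. Quantifying over \<open>Z\<close> inside it allows the
  successor step to use the hypothesis for a larger set.\<close>

definition incomparable_families :: "'a \<Rightarrow> 'a \<Rightarrow> bool" where
  "incomparable_families X n \<longleftrightarrow>
     (\<forall>Z. \<exists>F. equinumerous F n \<and> \<not> contains_injective F \<and>
        (\<forall>A. A \<^bold>\<in> F \<longrightarrow> (\<exists>M. contains_product X M A \<and> \<not> embeds M Z)))"

lemma incomparable_families_zero: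
  assumes "is_empty n"
  shows "incomparable_families X n"
proof -
  have "\<exists>f. is_injection f n n \<and> (\<forall>a b. related f a b \<longleftrightarrow> a \<^bold>\<in> n \<and> b \<^bold>\<in> n \<and> a = b)"
    by (rule injection_exists, intro definable_intros) auto
  \<comment> \<open>The empty set \<open>n\<close> itself serves as the family.\<close>
  then have "equinumerous n n"
    unfolding equinumerous_def is_bijection_def by blast
  then show ?thesis
    using assms unfolding incomparable_families_def contains_injective_def is_empty_def by blast
qed

lemma incomparable_families_succ:
  assumes X: "\<not> (\<exists>r. is_well_ordering r X)" and n: "incomparable_families X n" "is_succ n m"
  shows "incomparable_families X m"
  unfolding incomparable_families_def
proof
  fix Z
  obtain L where L: "is_ordinal L" "\<not> embeds L Z" using hartogs by blast
  obtain P where P: "\<And>p. p \<^bold>\<in> P \<longleftrightarrow> (\<exists>x l. x \<^bold>\<in> X \<and> l \<^bold>\<in> L \<and> is_pair x l p)"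
    using product_exists by metis
  \<comment> \<open>Avoiding \<open>Z'\<close> serves twice: \<open>P\<close> excludes embeddings of
    old members into \<open>N\<close>, and \<open>Z\<close> preserves the invariant.\<close>
  obtain Z' where Z': "\<And>x. x \<^bold>\<in> Z' \<longleftrightarrow> x \<^bold>\<in> Z \<or> x \<^bold>\<in> P" using union_exists by metis
  obtain F where F: "equinumerous F n" "\<not> contains_injective F"
    "\<And>A. A \<^bold>\<in> F \<Longrightarrow> \<exists>M. contains_product X M A \<and> \<not> embeds M Z'"
    using n(1) unfolding incomparable_families_def by blast
  obtain U where U: "\<And>x. x \<^bold>\<in> U \<longleftrightarrow> (\<exists>A. A \<^bold>\<in> F \<and> x \<^bold>\<in> A)" using union by metis
  obtain K where K: "is_ordinal K" "\<not> embeds K U" using hartogs by blast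
  obtain N where N: "\<And>x. x \<^bold>\<in> N \<longleftrightarrow> x \<^bold>\<in> P \<or> x \<^bold>\<in> K" using union_exists by metis
  obtain G where G: "\<And>x. x \<^bold>\<in> G \<longleftrightarrow> x \<^bold>\<in> F \<or> x = N" using insert_exists by metis
  have N_A: "\<not> embeds N A" if "A \<^bold>\<in> F" for A
  proof
    assume "embeds N A"
    moreover have "subset_of K N" "subset_of A U"
      using that by (auto simp: subset_of_def N U)
    \<comment> \<open>Restricting the source to \<open>K\<close> and enlarging the target to
      \<open>U\<close> contradicts the choice of \<open>K\<close>.\<close>
    ultimately show False using K(2) embeds_mono by blast
  qed
  have A_N: "\<not> embeds A N" if "A \<^bold>\<in> F" for A
  proof
    assume "embeds A N"
    moreover obtain M where M: "contains_product X M A" "\<not> embeds M Z'" using F(3)[OF \<open>A \<^bold>\<in> F\<close>] by blast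
    ultimately have "embeds M P \<or> embeds X K"
      using embeds_product_union[OF M(1) _ K(1) N] by blast
    moreover have "subset_of M M" "subset_of P Z'" by (auto simp: subset_of_def Z')
    ultimately show False
      using M(2) embeds_mono well_ordering_of_embedding[OF K(1)] X by blast
  qed
  \<comment> \<open>Otherwise the identity would embed \<open>N\<close> in a member of
    \<open>F\<close>. Hence adding \<open>N\<close> really increases the cardinality.\<close>
  have "\<not> N \<^bold>\<in> F"
    using N_A embeds_subset[of N N] by (auto simp: subset_of_def)
  then have "equinumerous G m"
    using equinumerous_insert[OF F(1) _ G n(2)] by blast
  moreover have "\<not> contains_injective G"
    using F(2) N_A A_N unfolding contains_injective_def G by blast
  moreover have "\<exists>M. contains_product X M A \<and> \<not> embeds M Z" if "A \<^bold>\<in> G" for A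
  proof (cases "A = N")
    case True
    have "contains_product X L N"
      unfolding contains_product_def N P using pair_exists by blast
    with True L show ?thesis by blast
  next
    case False
    then obtain M where M: "contains_product X M A" "\<not> embeds M Z'"
      using \<open>A \<^bold>\<in> G\<close> F(3) G by blast
    moreover have "subset_of M M" "subset_of Z Z'" by (auto simp: subset_of_def Z')
    ultimately show ?thesis using embeds_mono by blast
  qed
  ultimately show "\<exists>F. equinumerous F m \<and> \<not> contains_injective F \<and>
      (\<forall>A. A \<^bold>\<in> F \<longrightarrow> (\<exists>M. contains_product X M A \<and> \<not> embeds M Z))"
    by blast
qed

text \<open>Induction over the model's own natural numbers, possibly non-standard: the numbers with
  the property are separated from an inductive set, and the result is again inductive.\<close>

lemma incomparable_families_natural:
  assumes X: "\<not> (\<exists>r. is_well_ordering r X)" and k: "is_natural k"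
  shows "incomparable_families X k"
proof -
  obtain I where I: "is_inductive I" using infinity by blast
  have "\<exists>J. \<forall>n. n \<^bold>\<in> J \<longleftrightarrow> n \<^bold>\<in> I \<and> incomparable_families X n"
    by (rule separation_definable,
        unfold incomparable_families_def contains_product_def language_defs)
      (intro definable_intros)
  then obtain J where J: "\<And>n. n \<^bold>\<in> J \<longleftrightarrow> n \<^bold>\<in> I \<and> incomparable_families X n" by blast
  have "is_inductive J"
    using I incomparable_families_zero incomparable_families_succ[OF X]
    unfolding is_inductive_def J by blast
  then show ?thesis using k J unfolding is_natural_def by blast
qed

lemma trichotomy_imp_well_ordering:
  assumes "is_natural k" "trichotomy_principle k"
  shows "well_ordering_principle"
  using incomparable_families_natural[OF _ assms(1)] assms(2)
  unfolding well_ordering_principle_def trichotomy_principle_def incomparable_families_def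
  by blast

end

theorem theorem1:
  fixes mem :: "'a \<Rightarrow> 'a \<Rightarrow> bool" and k :: 'a
  assumes "ZF_model mem"
    and "membership.is_natural mem k"
    and "membership.trichotomy_principle mem k"
  shows "membership.well_ordering_principle mem"
  by (rule ZF_model.trichotomy_imp_well_ordering[OF assms])

end
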